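(* Let $\lambda$ be an $r$-partition and let $\alpha := \alpha_\kappa(\lambda)\in Q^+$. Assume that $\kappa$ is compatible with $(d,\eta,p)$. If $\sigma\cdot\alpha=\alpha$ then there is an $r$-partition $\mu$ with $\alpha_\kappa(\mu)=\alpha$ and ${}^{\sigma}\mu=\mu$.
   Context: Let $d,\eta,p\geq 1$ be integers, put $e := \eta p$ (assumed $\geq 2$) and $r := dp$. Identify $\mathbb{Z}/e\mathbb{Z}$ with $\{0,\dots,e-1\}$ and $\mathbb{Z}/r\mathbb{Z}$ with $\{0,\dots,r-1\}$. A multicharge $\kappa=(\kappa_0,\dots,\kappa_{r-1})\in(\mathbb{Z}/e\mathbb{Z})^r$ is compatible with $(d,\eta,p)$ if $\kappa_{k+d}=\kappa_k+\eta$ for all $k\in\mathbb{Z}/r\mathbb{Z}$. A partition is a finite non-increasing sequence of positive integers $\lambda=(\lambda_0,\dots,\lambda_{h-1})$; its Young diagram is $\mathcal{Y}(\lambda)=\{(a,b)\in\mathbb{N}^2 : 0\le a\le h-1,\ 0\le b\le\lambda_a-1\}$. An $r$-partition is an $r$-tuple $\lambda=(\lambda^{(0)},\dots,\lambda^{(r-1)})$ of partitions; its Young diagram is $\mathcal{Y}(\lambda)=\bigcup_{c=0}^{r-1}\mathcal{Y}(\lambda^{(c)})\times\{c\}$. The $\kappa$-residue of a node $(a,b,c)$ is $\mathrm{res}_\kappa(a,b,c)=b-a+\kappa_c\in\mathbb{Z}/e\mathbb{Z}$. Let $Q=\bigoplus_{i\in\mathbb{Z}/e\mathbb{Z}}\mathbb{Z}\alpha_i$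 be a free $\mathbb{Z}$-module with basis $(\alpha_i)_{i\in\mathbb{Z}/e\mathbb{Z}}$ and $Q^+=\bigoplus_i\mathbb{N}\alpha_i$. For an $r$-partition $\lambda$ put $\alpha_\kappa(\lambda)=\sum_{\gamma\in\mathcal{Y}(\lambda)}\alpha_{\mathrm{res}_\kappa(\gamma)}\in Q^+$. Shifts: on $Q$, $\sigma$ is the $\mathbb{Z}$-linear map with $\sigma\cdot\alpha_i=\alpha_{i+\eta}$; on $r$-partitions, ${}^{\sigma}\lambda=(\lambda^{(r-d)},\dots,\lambda^{(r-1)},\lambda^{(0)},\dots,\lambda^{(r-d-1)})$. *)

theory Defs
  imports Main "HOL-Library.Poly_Mapping"
begin

text \<open>
  Elements of \<open>\<int>/e\<int>\<close> are represented by their representatives in \<open>{0..<int e}\<close>. The lattice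
  \<open>Q\<close> is the subgroup of \<^typ>\<open>int \<Rightarrow>\<^sub>0 int\<close>, the free abelian group over \<^typ>\<open>int\<close>, generated by
  the \<open>frag_of i\<close> with \<open>i \<in> {0..<int e}\<close>; thus \<open>frag_of i\<close> plays the role of \<open>\<alpha>\<^sub>i\<close>.
\<close>

definition root_lattice :: "nat \<Rightarrow> (int \<Rightarrow>\<^sub>0 int) set" where
  "root_lattice e = {x. Poly_Mapping.keys x \<subseteq> {0..<int e}}"

definition pos_root_lattice :: "nat \<Rightarrow> (int \<Rightarrow>\<^sub>0 int) set" where
  "pos_root_lattice e = {x \<in> root_lattice e. \<forall>i. 0 \<le> Poly_Mapping.lookup x i}"

definition shift_Q :: "nat \<Rightarrow> nat \<Rightarrow> (int \<Rightarrow>\<^sub>0 int) \<Rightarrow> (int \<Rightarrow>\<^sub>0 int)" where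
  "shift_Q e \<eta> = frag_extend (\<lambda>i. frag_of ((i + int \<eta>) mod int e))"

definition multicharge :: "nat \<Rightarrow> nat \<Rightarrow> int list \<Rightarrow> bool" where
  "multicharge e r \<kappa> \<longleftrightarrow> length \<kappa> = r \<and> set \<kappa> \<subseteq> {0..<int e}"

text \<open>Indices are read in \<open>\<int>/r\<int>\<close> with \<open>r = d * p\<close>, values in \<open>\<int>/e\<int>\<close> with \<open>e = \<eta> * p\<close>.\<close>

definition compatible :: "nat \<Rightarrow> nat \<Rightarrow> nat \<Rightarrow> int list \<Rightarrow> bool" where
  "compatible d \<eta> p \<kappa> \<longleftrightarrow>
    (\<forall>k < d * p. \<kappa> ! ((k + d) mod (d * p)) = (\<kappa> ! k + int \<eta>) mod int (\<eta> * p))"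

definition is_partition :: "nat list \<Rightarrow> bool" where
  "is_partition xs \<longleftrightarrow> sorted_wrt (\<ge>) xs \<and> (\<forall>x \<in> set xs. 0 < x)"

definition young_diagram :: "nat list \<Rightarrow> (nat \<times> nat) set" where
  "young_diagram xs = {(a, b). a < length xs \<and> b < xs ! a}"

definition is_multipartition :: "nat \<Rightarrow> nat list list \<Rightarrow> bool" where
  "is_multipartition r L \<longleftrightarrow> length L = r \<and> (\<forall>xs \<in> set L. is_partition xs)"

definition multi_young_diagram :: "nat list list \<Rightarrow> (nat \<times> nat \<times> nat) set" where
  "multi_young_diagram L = {(a, b, c). c < length L \<and> (a, b) \<in> young_diagram (L ! c)}"

definition residue :: "nat \<Rightarrow> int list \<Rightarrow> nat \<times> nat \<times> nat \<Rightarrow> int" where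
  "residue e \<kappa> = (\<lambda>(a, b, c). (int b - int a + \<kappa> ! c) mod int e)"

definition alpha :: "nat \<Rightarrow> int list \<Rightarrow> nat list list \<Rightarrow> (int \<Rightarrow>\<^sub>0 int)" where
  "alpha e \<kappa> L = (\<Sum>\<gamma> \<in> multi_young_diagram L. frag_of (residue e \<kappa> \<gamma>))"

definition shift_multipartition :: "nat \<Rightarrow> nat list list \<Rightarrow> nat list list" where
  "shift_multipartition d L = drop (length L - d) L @ take (length L - d) L"

lemma finite_multi_young_diagram: "finite (multi_young_diagram L)"
proof -
  have "multi_young_diagram L = (\<Union>c<length L. \<Union>a<length (L ! c). \<Union>b<L ! c ! a. {(a, b, c)})"
    by (auto simp: multi_young_diagram_def young_diagram_def)
  then show ?thesis by simp
qed

lemma shift_Q_frag_of: "shift_Q e \<eta> (frag_of i) = frag_of ((i + int \<eta>) mod int e)"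
  by (simp add: shift_Q_def)

lemma shift_Q_add: "shift_Q e \<eta> (x + y) = shift_Q e \<eta> x + shift_Q e \<eta> y"
  by (simp add: shift_Q_def frag_extend_add)

lemma alpha_in_pos_root_lattice:
  assumes "0 < e"
  shows "alpha e \<kappa> L \<in> pos_root_lattice e"
proof -
  have "(\<Sum>\<gamma>\<in>A. frag_of (residue e \<kappa> \<gamma>)) \<in> pos_root_lattice e" if "finite A" for A
    using that
  proof (induction A rule: finite_induct)
    case empty
    show ?case by (simp add: pos_root_lattice_def root_lattice_def)
  next
    case (insert \<gamma> A)
    let ?s = "\<Sum>\<gamma>\<in>A. frag_of (residue e \<kappa> \<gamma>)"
    have "residue e \<kappa> \<gamma> \<in> {0..<int e}"
      using assms by (simp add: residue_def split_beta)
    then have "Poly_Mapping.keys (frag_of (residue e \<kappa> \<gamma>) + ?s) \<subseteq> {0..<int e}"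
      using insert.IH Poly_Mapping.keys_add[of "frag_of (residue e \<kappa> \<gamma>)" ?s]
      by (force simp: pos_root_lattice_def root_lattice_def)
    moreover have "0 \<le> Poly_Mapping.lookup (frag_of (residue e \<kappa> \<gamma>) + ?s) i" for i
      using insert.IH
      by (simp add: pos_root_lattice_def lookup_add)
    ultimately show ?case
      using insert.hyps by (simp add: pos_root_lattice_def root_lattice_def)
  qed
  then show ?thesis
    unfolding alpha_def using finite_multi_young_diagram by blast
qed

end

theory Submission
  imports Defs "HOL-Library.Multiset"
begin

text \<open>
  The shift \<open>\<sigma>\<close> permutes the residues in \<open>\<int>/e\<int>\<close> by adding \<open>\<eta>\<close>, and a compatible multicharge is
  determined by its first \<open>d\<close> entries up to this permutation. This reduces the theorem to a question
  in which only residues modulo \<open>\<eta>\<close> occur. Let \<open>f i\<close> be the multiplicity of \<open>i\<close> in \<open>\<alpha>\<close>. As \<open>\<alpha>\<close> is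
  \<open>\<sigma>\<close>-stable, \<open>f\<close> has period \<open>\<eta>\<close>, and so the given multipartition with \<open>d p\<close> components has \<open>p f i\<close>
  nodes of residue \<open>i\<close> modulo \<open>\<eta>\<close> (\<open>residue_count_coarsen\<close>). Conversely, if a multipartition with \<open>d\<close>
  components has \<open>f i\<close> nodes of residue \<open>i\<close> modulo \<open>\<eta>\<close>, then the concatenation of \<open>p\<close> copies of it is
  fixed by the shift and has content \<open>\<alpha>\<close> (\<open>residue_count_concat_replicate\<close>): the \<open>p\<close> copies of a node
  have the \<open>p\<close> different residues modulo \<open>e\<close> that lie over its residue modulo \<open>\<eta>\<close>.

  It remains to divide a content by \<open>p\<close>: if \<open>p f\<close> is the content modulo \<open>n\<close> of some diagram with \<open>d p\<close>
  components whose charges modulo \<open>n\<close> repeat with period \<open>d\<close>, then \<open>f\<close> is the content of a diagram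
  with \<open>d\<close> components (\<open>content_divisible\<close>). For \<open>n \<ge> 2\<close> this is a statement about the affine Lie
  algebra of type \<open>A\<^bsub>n-1\<^esub>\<^sup>(\<^sup>1\<^sup>)\<close>: if \<open>p\<close> times a weight in \<open>\<Lambda> - Q\<close> occurs in the \<open>p\<close>-th power of a
  tensor product of \<open>d\<close> Fock spaces of total highest weight \<open>\<Lambda>\<close>, then the weight itself occurs in the
  tensor product. The argument is the classical one for weights of integrable modules, made
  combinatorial. Attach to \<open>f\<close> and \<open>i\<close> the number
    \<open>h\<^sub>i(f) = #{c. \<kappa>\<^sub>c = i} + f (i - 1) + f (i + 1) - 2 f i\<close>.
  If \<open>f\<close> is the content of a diagram, then \<open>h\<^sub>i(f)\<close> is the number of its addable \<open>i\<close>-nodes minus the number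
  of its removable \<open>i\<close>-nodes (\<open>addable_minus_removable\<close>), so its sign tells whether \<open>i\<close>-nodes can be
  added or removed.

  If \<open>h\<^sub>i(f) < 0\<close> for some \<open>i\<close>, the reflection that replaces \<open>f i\<close> by \<open>f i + h\<^sub>i(f)\<close> commutes with
  multiplication by \<open>p\<close>: nodes are removed from the large diagram, the smaller content is divided
  by induction, and the nodes missing from the small diagram are added back.

  If \<open>h\<^sub>i(f) \<ge> 0\<close> for all \<open>i\<close>, that is, if \<open>f\<close> is dominant, a diagram of content \<open>f\<close> is found
  greedily, as a largest one whose content is at most \<open>f\<close> (\<open>dominant_content_realizable\<close>). Let the
  defect \<open>g\<close> be \<open>f\<close> minus the content of this diagram. Where \<open>g\<close> is positive at \<open>i\<close>, no \<open>i\<close>-node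
  can be added, which forces \<open>2 g i \<le> g (i - 1) + g (i + 1)\<close>. By the maximum principle
  on the cycle \<open>\<int>/n\<int>\<close> a nonzero defect would then be positive everywhere, although every diagram has an
  addable node of some residue.
\<close>

section \<open>Multidiagrams and their boundary nodes\<close>

text \<open>
  Young diagrams of multipartitions are handled as sets that are closed towards the origin in each
  component, so that adding or removing several boundary nodes at once is a union or a difference.
\<close>

definition multidiagram :: "nat \<Rightarrow> (nat \<times> nat \<times> nat) set \<Rightarrow> bool" where
  "multidiagram r D \<longleftrightarrow> finite D \<and> (\<forall>a b c. (a, b, c) \<in> D \<longrightarrow> c < r) \<and>
     (\<forall>a b c. (Suc a, b, c) \<in> D \<longrightarrow> (a, b, c) \<in> D) \<and>
     (\<forall>a b c. (a, Suc b, c) \<in> D \<longrightarrow> (a, b, c) \<in> D)"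

definition addable :: "nat \<Rightarrow> (nat \<times> nat \<times> nat) set \<Rightarrow> (nat \<times> nat \<times> nat) set" where
  "addable r D = {(a, b, c). c < r \<and> (a, b, c) \<notin> D \<and>
     (\<forall>a'. a = Suc a' \<longrightarrow> (a', b, c) \<in> D) \<and> (\<forall>b'. b = Suc b' \<longrightarrow> (a, b', c) \<in> D)}"

definition removable :: "(nat \<times> nat \<times> nat) set \<Rightarrow> (nat \<times> nat \<times> nat) set" where
  "removable D = {(a, b, c). (a, b, c) \<in> D \<and> (Suc a, b, c) \<notin> D \<and> (a, Suc b, c) \<notin> D}"

text \<open>
  The index \<open>i\<close> is read modulo \<open>n\<close>, so that contents are \<open>n\<close>-periodic functions and no
  representatives need to be chosen for \<open>i - 1\<close> and \<open>i + 1\<close>.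
\<close>
definition residue_count :: "nat \<Rightarrow> int list \<Rightarrow> (nat \<times> nat \<times> nat) set \<Rightarrow> int \<Rightarrow> int" where
  "residue_count n \<kappa> D i = int (card {x \<in> D. residue n \<kappa> x = i mod int n})"

definition charge_count :: "nat \<Rightarrow> int list \<Rightarrow> nat \<Rightarrow> int \<Rightarrow> int" where
  "charge_count n \<kappa> r i = int (card {c. c < r \<and> \<kappa> ! c mod int n = i mod int n})"

text \<open>
  The value of the weight \<open>\<Lambda> - \<Sum>\<^sub>j f j \<alpha>\<^sub>j\<close> at the simple coroot with index \<open>i\<close>, where \<open>\<Lambda>\<close> is the
  sum of the fundamental weights given by the charges. For \<open>n = 2\<close> the neighbours \<open>i - 1\<close> and
  \<open>i + 1\<close> coincide, which yields the entry \<open>-2\<close> of that Cartan matrix. For \<open>n = 1\<close> the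
  terms in \<open>f\<close> cancel.
\<close>
definition weight :: "nat \<Rightarrow> int list \<Rightarrow> nat \<Rightarrow> (int \<Rightarrow> int) \<Rightarrow> int \<Rightarrow> int" where
  "weight n \<kappa> r f i = charge_count n \<kappa> r i + f (i - 1) + f (i + 1) - 2 * f i"

lemma multidiagramI:
  assumes "finite D" "\<And>a b c. (a, b, c) \<in> D \<Longrightarrow> c < r"
    and "\<And>a b c. (Suc a, b, c) \<in> D \<Longrightarrow> (a, b, c) \<in> D"
    and "\<And>a b c. (a, Suc b, c) \<in> D \<Longrightarrow> (a, b, c) \<in> D"
  shows "multidiagram r D"
  unfolding multidiagram_def using assms by blast

lemma multidiagramD:
  assumes "multidiagram r D"
  shows "finite D" "(a, b, c) \<in> D \<Longrightarrow> c < r"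
    and "(Suc a, b, c) \<in> D \<Longrightarrow> (a, b, c) \<in> D"
    and "(a, Suc b, c) \<in> D \<Longrightarrow> (a, b, c) \<in> D"
  using assms unfolding multidiagram_def by (iprover)+

lemma residue_count_mod: "residue_count n \<kappa> D (i mod int n) = residue_count n \<kappa> D i"
  by (simp add: residue_count_def)

lemma residue_count_cong:
  "i mod int n = j mod int n \<Longrightarrow> residue_count n \<kappa> D i = residue_count n \<kappa> D j"
  by (simp add: residue_count_def)

lemma residue_count_nonneg: "0 \<le> residue_count n \<kappa> D i"
  by (simp add: residue_count_def)

lemma residue_count_eq_sum:
  "finite D \<Longrightarrow> residue_count n \<kappa> D i = (\<Sum>x\<in>D. of_bool (residue n \<kappa> x = i mod int n))"
  by (simp add: residue_count_def sum.If_cases of_bool_def Int_def)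

lemma residue_count_Un_disjoint:
  assumes "finite D" "finite E" "D \<inter> E = {}"
  shows "residue_count n \<kappa> (D \<union> E) i = residue_count n \<kappa> D i + residue_count n \<kappa> E i"
  unfolding residue_count_eq_sum[OF assms(1)] residue_count_eq_sum[OF assms(2)]
    residue_count_eq_sum[OF finite_UnI[OF assms(1,2)]]
  by (rule sum.union_disjoint[OF assms])

lemma residue_count_homogeneous:
  assumes "S \<subseteq> {x. residue n \<kappa> x = i mod int n}"
  shows "residue_count n \<kappa> S j = (if j mod int n = i mod int n then int (card S) else 0)"
proof -
  have "{x \<in> S. residue n \<kappa> x = j mod int n} = (if j mod int n = i mod int n then S else {})"
    using assms by auto
  then show ?thesis
    by (simp add: residue_count_def)
qed

lemma residue_count_image:
  assumes "inj_on g D"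
    and "\<And>x. x \<in> D \<Longrightarrow> residue n \<kappa> (g x) = i mod int n \<longleftrightarrow> residue n \<kappa> x = j mod int n"
  shows "residue_count n \<kappa> (g ` D) i = residue_count n \<kappa> D j"
proof -
  have "{x \<in> g ` D. residue n \<kappa> x = i mod int n} = g ` {x \<in> D. residue n \<kappa> x = j mod int n}"
    using assms(2) by auto
  moreover have "inj_on g {x \<in> D. residue n \<kappa> x = j mod int n}"
    using assms(1) by (rule inj_on_subset) auto
  ultimately show ?thesis
    by (simp add: residue_count_def card_image)
qed

lemma multidiagram_Un_addable:
  assumes "multidiagram r D" "S \<subseteq> addable r D" "finite S"
  shows "multidiagram r (D \<union> S)"
proof -
  have "(a, b, c) \<in> D" if "(Suc a, b, c) \<in> S" for a b c
    using assms(2) that by (auto simp: addable_def)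
  moreover have "(a, b, c) \<in> D" if "(a, Suc b, c) \<in> S" for a b c
    using assms(2) that by (auto simp: addable_def)
  moreover have "c < r" if "(a, b, c) \<in> S" for a b c
    using assms(2) that by (auto simp: addable_def)
  ultimately show ?thesis
    using multidiagramD[OF assms(1)] assms(3) by (intro multidiagramI) blast+
qed

lemma multidiagram_Diff_removable:
  assumes "multidiagram r D" "S \<subseteq> removable D"
  shows "multidiagram r (D - S)"
proof -
  have "(Suc a, b, c) \<notin> D" "(a, Suc b, c) \<notin> D" if "(a, b, c) \<in> S" for a b c
    using assms(2) that by (auto simp: removable_def)
  then show ?thesis
    using multidiagramD[OF assms(1)] by (intro multidiagramI) blast+
qed

text \<open>
  The nodes \<open>(a, b)\<close> and \<open>(a - 1, b - 1)\<close> have the same residue. Let \<open>u\<close>, \<open>s\<close>, \<open>t\<close>, \<open>w\<close> be the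
  indicators of \<open>(a, b)\<close>, \<open>(a - 1, b)\<close>, \<open>(a, b - 1)\<close>, \<open>(a - 1, b - 1)\<close>, so that
  \<open>u \<le> s, t \<le> w\<close>. Then \<open>(a, b)\<close> is addable iff \<open>(1 - u) s t = s t - u\<close> is \<open>1\<close>, and \<open>(a - 1, b - 1)\<close> is
  removable iff \<open>w (1 - s) (1 - t) = w - s - t + s t\<close> is \<open>1\<close>. The product \<open>s t\<close> cancels in the difference
  \<open>s + t - u - w\<close>, which leaves a linear identity between indicators; on the two axes it holds
  with a correction at the corner of each component. Moving the removable nodes along the
  diagonal turns this into an equation of multisets.
\<close>
lemma boundary_multiset_identity:
  assumes D: "multidiagram r D"
  defines "down \<equiv> \<lambda>(a, b, c). (Suc a, b, c)"
    and "right \<equiv> \<lambda>(a, b, c). (a, Suc b, c)"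
    and "diag \<equiv> \<lambda>(a, b, c). (Suc a, Suc b, c)"
  shows "finite (addable r D)"
    and "mset_set (addable r D) + mset_set D + mset_set (diag ` D) =
      mset_set (diag ` removable D) + mset_set (down ` D) + mset_set (right ` D) +
      mset_set ({0} \<times> {0} \<times> {..<r})"
proof -
  have fin: "finite D" "finite (removable D)"
    using multidiagramD(1)[OF D] finite_subset[of "removable D" D]
    by (auto simp: removable_def)
  have "addable r D \<subseteq> down ` D \<union> right ` D \<union> {0} \<times> {0} \<times> {..<r}"
  proof
    fix x assume x: "x \<in> addable r D"
    obtain a b c where abc: "x = (a, b, c)" by (cases x)
    show "x \<in> down ` D \<union> right ` D \<union> {0} \<times> {0} \<times> {..<r}"
    proof (cases a)
      case (Suc a')
      then have "(a', b, c) \<in> D" "x = down (a', b, c)"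
        using x by (auto simp: abc addable_def down_def)
      then show ?thesis by blast
    next
      case a: 0
      show ?thesis
      proof (cases b)
        case (Suc b')
        then have "(a, b', c) \<in> D" "x = right (a, b', c)"
          using x by (auto simp: abc addable_def right_def)
        then show ?thesis by blast
      next
        case 0
        then show ?thesis using x a by (auto simp: abc addable_def)
      qed
    qed
  qed
  then show finA: "finite (addable r D)"
    using fin by (auto intro: finite_subset)
  show "mset_set (addable r D) + mset_set D + mset_set (diag ` D) =
      mset_set (diag ` removable D) + mset_set (down ` D) + mset_set (right ` D) +
      mset_set ({0} \<times> {0} \<times> {..<r})"
  proof (rule multiset_eqI)
    fix x :: "nat \<times> nat \<times> nat"
    obtain a b c where x: "x = (a, b, c)" by (cases x)
    have down: "(a, b, c) \<in> down ` X \<longleftrightarrow> (\<exists>a'. a = Suc a' \<and> (a', b, c) \<in> X)" for X a b c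
      by (force simp: down_def)
    have right: "(a, b, c) \<in> right ` X \<longleftrightarrow> (\<exists>b'. b = Suc b' \<and> (a, b', c) \<in> X)" for X a b c
      by (force simp: right_def)
    have diag: "(a, b, c) \<in> diag ` X \<longleftrightarrow> 
      (\<exists>a' b'. a = Suc a' \<and> b = Suc b' \<and> (a', b', c) \<in> X)" for X a b c
      by (force simp: diag_def)
    have bound: "(a', b', c) \<in> D \<Longrightarrow> c < r" for a' b'
      by (rule multidiagramD(2)[OF D])
    have up: "(Suc a', b', c) \<in> D \<Longrightarrow> (a', b', c) \<in> D" for a' b'
      by (rule multidiagramD(3)[OF D])
    have left: "(a', Suc b', c) \<in> D \<Longrightarrow> (a', b', c) \<in> D" for a' b'
      by (rule multidiagramD(4)[OF D])
    have addable: "(a, b, c) \<in> addable r D \<longleftrightarrow> c < r \<and> (a, b, c) \<notin> D \<and>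
      (\<forall>a'. a = Suc a' \<longrightarrow> (a', b, c) \<in> D) \<and> (\<forall>b'. b = Suc b' \<longrightarrow> (a, b', c) \<in> D)" for a b c
      by (simp add: addable_def)
    have removable: "(a, b, c) \<in> removable D \<longleftrightarrow>
      (a, b, c) \<in> D \<and> (Suc a, b, c) \<notin> D \<and> (a, Suc b, c) \<notin> D" for a b c
      by (simp add: removable_def)
    note mem = count_mset_set' down right diag addable removable
    show "count (mset_set (addable r D) + mset_set D + mset_set (diag ` D)) x =
      count (mset_set (diag ` removable D) + mset_set (down ` D) + mset_set (right ` D) +
        mset_set ({0} \<times> {0} \<times> {..<r})) x"
    proof (cases a)
      case a: 0
      show ?thesis
      proof (cases b)
        case 0
        then show ?thesis
          using fin finA a bound[of 0 0] by (simp add: x mem)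
      next
        case (Suc b')
        then show ?thesis
          using fin finA a bound[of 0 b'] left[of 0 b'] by (simp add: x mem)
      qed
    next
      case a: (Suc a')
      show ?thesis
      proof (cases b)
        case 0
        then show ?thesis
          using fin finA a bound[of a' 0] up[of a' 0] by (simp add: x mem)
      next
        case (Suc b')
        then show ?thesis
          using fin finA a bound[of a' b'] up[of a' b'] up[of a' "Suc b'"]
            left[of a' b'] left[of "Suc a'" b']
          by (simp add: x mem)
      qed
    qed
  qed
qed

text \<open>
  Counting residues in the multiset identity: going down lowers the residue by one, going right
  raises it by one, and going along the diagonal keeps it.
\<close>
lemma addable_minus_removable:
  assumes D: "multidiagram r D"
  shows "residue_count n \<kappa> (addable r D) i - residue_count n \<kappa> (removable D) i =
    weight n \<kappa> r (residue_count n \<kappa> D) i"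
proof -
  define down right diag :: "nat \<times> nat \<times> nat \<Rightarrow> nat \<times> nat \<times> nat"
    where "down = (\<lambda>(a, b, c). (Suc a, b, c))"
      and "right = (\<lambda>(a, b, c). (a, Suc b, c))"
      and "diag = (\<lambda>(a, b, c). (Suc a, Suc b, c))"
  note defs = down_def right_def diag_def
  let ?N = "\<lambda>X. residue_count n \<kappa> X i"
  have fin: "finite D" "finite (removable D)"
    using multidiagramD(1)[OF D] finite_subset[of "removable D" D]
    by (auto simp: removable_def)
  note finA = boundary_multiset_identity(1)[OF D]
  have "?N (addable r D) + ?N D + ?N (diag ` D) =
    ?N (diag ` removable D) + ?N (down ` D) + ?N (right ` D) + ?N ({0} \<times> {0} \<times> {..<r})"
    using arg_cong[OF boundary_multiset_identity(2)[OF D],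
        of "\<lambda>X. int (size (filter_mset (\<lambda>x. residue n \<kappa> x = i mod int n) X))"]
    by (simp add: residue_count_def filter_mset_mset_set fin finA defs)
  moreover have "?N (diag ` X) = ?N X" for X
    by (rule residue_count_image) (auto simp: diag_def residue_def inj_on_def)
  moreover have "?N (down ` D) = residue_count n \<kappa> D (i + 1)"
  proof (rule residue_count_image)
    show "residue n \<kappa> (down x) = i mod int n \<longleftrightarrow> residue n \<kappa> x = (i + 1) mod int n" for x
      by (cases x) (simp add: down_def residue_def mod_eq_dvd_iff algebra_simps)
  qed (auto simp: down_def inj_on_def)
  moreover have "?N (right ` D) = residue_count n \<kappa> D (i - 1)"
  proof (rule residue_count_image)
    show "residue n \<kappa> (right x) = i mod int n \<longleftrightarrow> residue n \<kappa> x = (i - 1) mod int n" for x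
      by (cases x) (simp add: right_def residue_def mod_eq_dvd_iff algebra_simps)
  qed (auto simp: right_def inj_on_def)
  moreover have "?N ({0} \<times> {0} \<times> {..<r}) = charge_count n \<kappa> r i"
  proof -
    have "{x \<in> {0} \<times> {0} \<times> {..<r}. residue n \<kappa> x = i mod int n} =
      (\<lambda>c. (0, 0, c)) ` {c. c < r \<and> \<kappa> ! c mod int n = i mod int n}"
      by (auto simp: residue_def)
    then show ?thesis
      by (simp add: residue_count_def charge_count_def card_image inj_on_def)
  qed
  ultimately show ?thesis by (simp add: weight_def)
qed

section \<open>Adding and removing nodes of one residue\<close>

lemma add_nodes:
  assumes D: "multidiagram r D" and k: "int k \<le> weight n \<kappa> r (residue_count n \<kappa> D) i"
  obtains E where "multidiagram r E"
    "\<And>j. residue_count n \<kappa> E j =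
      residue_count n \<kappa> D j + (if j mod int n = i mod int n then int k else 0)"
proof -
  let ?A = "{x \<in> addable r D. residue n \<kappa> x = i mod int n}"
  have finA: "finite (addable r D)" and finD: "finite D"
    using boundary_multiset_identity(1)[OF D] multidiagramD(1)[OF D] by auto
  have "int k \<le> int (card ?A)"
    using k addable_minus_removable[OF D, of n \<kappa> i]
      residue_count_nonneg[of n \<kappa> "removable D" i]
    by (simp add: weight_def residue_count_def)
  then obtain S where S: "S \<subseteq> ?A" "card S = k" "finite S"
    using finA by (metis (no_types, lifting) obtain_subset_with_card_n of_nat_le_iff)
  have disj: "D \<inter> S = {}"
    using S(1) by (auto simp: addable_def)
  have hom: "S \<subseteq> {x. residue n \<kappa> x = i mod int n}"
    using S(1) by auto
  show thesis
  proof
    show "multidiagram r (D \<union> S)"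
      using S by (intro multidiagram_Un_addable D) auto
    show "residue_count n \<kappa> (D \<union> S) j =
      residue_count n \<kappa> D j + (if j mod int n = i mod int n then int k else 0)" for j
      using S disj finD residue_count_homogeneous[OF hom, of j]
      by (simp add: residue_count_Un_disjoint)
  qed
qed

lemma remove_nodes:
  assumes D: "multidiagram r D" and k: "weight n \<kappa> r (residue_count n \<kappa> D) i \<le> - int k"
  obtains E where "multidiagram r E" "card D = card E + k"
    "\<And>j. residue_count n \<kappa> E j =
      residue_count n \<kappa> D j - (if j mod int n = i mod int n then int k else 0)"
proof -
  let ?R = "{x \<in> removable D. residue n \<kappa> x = i mod int n}"
  have finD: "finite D" by (rule multidiagramD(1)[OF D])
  have "int k \<le> int (card ?R)"
    using k addable_minus_removable[OF D, of n \<kappa> i]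
      residue_count_nonneg[of n \<kappa> "addable r D" i]
    by (simp add: weight_def residue_count_def)
  then obtain S where S: "S \<subseteq> ?R" "card S = k" "finite S"
    by (metis (no_types, lifting) obtain_subset_with_card_n of_nat_le_iff)
  have sub: "S \<subseteq> D"
    using S(1) by (auto simp: removable_def)
  have hom: "S \<subseteq> {x. residue n \<kappa> x = i mod int n}"
    using S(1) by auto
  show thesis
  proof
    show "multidiagram r (D - S)"
      using S by (intro multidiagram_Diff_removable D) auto
    show "card D = card (D - S) + k"
      using sub S finD by (metis add.commute card_Diff_subset card_mono le_add_diff_inverse)
    have "residue_count n \<kappa> D j = residue_count n \<kappa> (D - S) j + residue_count n \<kappa> S j" for j
      using residue_count_Un_disjoint[of "D - S" S n \<kappa> j] sub S finD
      by (auto simp: Un_absorb2)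
    then show "residue_count n \<kappa> (D - S) j =
      residue_count n \<kappa> D j - (if j mod int n = i mod int n then int k else 0)" for j
      using S residue_count_homogeneous[OF hom, of j] by simp
  qed
qed

section \<open>Dominant contents\<close>

text \<open>Bounds the size of the diagrams with a given upper bound on their content.\<close>
lemma card_le_sum_residue_count:
  assumes "0 < n" "finite D"
  shows "int (card D) \<le> (\<Sum>i\<in>{0..<int n}. residue_count n \<kappa> D i)"
proof -
  have "D = (\<Union>i\<in>{0..<int n}. {x \<in> D. residue n \<kappa> x = i mod int n})"
  proof -
    have "residue n \<kappa> x \<in> {0..<int n} \<and> residue n \<kappa> x = residue n \<kappa> x mod int n" for x
      using assms(1) by (cases x) (simp add: residue_def)
    then show ?thesis by blast
  qed
  then have "card D = card (\<Union>i\<in>{0..<int n}. {x \<in> D. residue n \<kappa> x = i mod int n})"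
    by (rule arg_cong)
  also have "\<dots> \<le> (\<Sum>i\<in>{0..<int n}. card {x \<in> D. residue n \<kappa> x = i mod int n})"
    by (rule card_UN_le) simp
  finally have "card D \<le> (\<Sum>i\<in>{0..<int n}. card {x \<in> D. residue n \<kappa> x = i mod int n})" .
  then have "int (card D) \<le> int (\<Sum>i\<in>{0..<int n}. card {x \<in> D. residue n \<kappa> x = i mod int n})"
    by (simp only: of_nat_le_iff)
  then show ?thesis
    by (simp add: residue_count_def)
qed

text \<open>The first row of the component \<open>0\<close> can be extended, because it is finite.\<close>
lemma addable_nonempty:
  assumes D: "multidiagram r D" and r: "0 < r"
  obtains x where "x \<in> addable r D"
proof -
  have "\<exists>b. (0, b, 0) \<notin> D"
  proof (rule ccontr)
    assume "\<nexists>b. (0, b, 0) \<notin> D"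
    then have "range (\<lambda>b::nat. (0::nat, b, 0::nat)) \<subseteq> D" by auto
    then have "finite (range (\<lambda>b::nat. (0::nat, b, 0::nat)))"
      using multidiagramD(1)[OF D] by (rule finite_subset)
    moreover have "inj (\<lambda>b::nat. (0::nat, b, 0::nat))" by (auto simp: inj_on_def)
    ultimately show False using finite_imageD by blast
  qed
  define b where "b = (LEAST b. (0, b, 0) \<notin> D)"
  have "(0, b, 0) \<notin> D" "\<And>b'. b' < b \<Longrightarrow> (0, b', 0) \<in> D"
    using LeastI_ex[OF \<open>\<exists>b. (0, b, 0) \<notin> D\<close>] not_less_Least[of _ "\<lambda>b. (0, b, 0) \<notin> D"]
    unfolding b_def by blast+
  then have "(0, b, 0) \<in> addable r D"
    using r by (auto simp: addable_def)
  then show thesis by (rule that)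
qed

text \<open>
  The maximum principle on the cycle \<open>\<int>/n\<int>\<close>: the inequality forces the neighbours of a point
  where the positive maximum is attained to attain it as well.
\<close>
lemma periodic_subharmonic_positive:
  fixes g :: "int \<Rightarrow> int"
  assumes n: "0 < n" and per: "\<And>i. g (i mod int n) = g i"
    and pos: "\<exists>i. 0 < g i"
    and conv: "\<And>i. 0 < g i \<Longrightarrow> 2 * g i \<le> g (i - 1) + g (i + 1)"
  shows "0 < g j"
proof -
  let ?G = "Max (g ` {0..<int n})"
  have le: "g i \<le> ?G" for i
  proof -
    have "g (i mod int n) \<le> ?G" using n by (intro Max_ge) auto
    then show ?thesis by (simp add: per)
  qed
  have Gpos: "0 < ?G" using pos le by (meson order_less_le_trans)
  have "?G \<in> g ` {0..<int n}" using n by (intro Max_in) auto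
  then obtain m where m: "g m = ?G" by auto
  have up: "g (m + int t) = ?G" for t
  proof (induction t)
    case (Suc t)
    then show ?case
      using conv[of "m + int t"] le[of "m + int t - 1"] le[of "m + int t + 1"] Gpos
      by (simp add: algebra_simps)
  qed (simp add: m)
  have "g j = g (m + int (nat ((j - m) mod int n)))"
  proof -
    have "(m + (j - m) mod int n) mod int n = j mod int n"
      by (simp add: mod_simps)
    then show ?thesis
      using n per[of j] per[of "m + (j - m) mod int n"] by simp
  qed
  then show ?thesis using up Gpos by presburger
qed

text \<open>
  A largest diagram among those with content at most \<open>f\<close> works. Let \<open>g\<close> be the difference of \<open>f\<close> and
  its content. If \<open>g i > 0\<close>, then no \<open>i\<close>-node is addable, so the weight of the content at \<open>i\<close> is at
  most \<open>0\<close>, while the weight of \<open>f\<close> at \<open>i\<close> is at least \<open>0\<close>. Subtracting the two weights cancels the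
  charges and leaves the subharmonicity of \<open>g\<close> at \<open>i\<close>.
\<close>
lemma dominant_content_realizable:
  assumes n: "0 < n" and r: "0 < r"
    and per: "\<And>i. f (i mod int n) = f i" and nonneg: "\<And>i. 0 \<le> f i"
    and dom: "\<And>i. 0 \<le> weight n \<kappa> r f i"
  obtains D where "multidiagram r D" "\<And>i. residue_count n \<kappa> D i = f i"
proof -
  define P where "P D \<longleftrightarrow> multidiagram r D \<and> (\<forall>i. residue_count n \<kappa> D i \<le> f i)" for D
  have "P {}" using nonneg by (simp add: P_def multidiagram_def residue_count_def)
  moreover have "card D < Suc (nat (\<Sum>i\<in>{0..<int n}. f i))" if "P D" for D
  proof -
    have "int (card D) \<le> (\<Sum>i\<in>{0..<int n}. residue_count n \<kappa> D i)"
      using that n multidiagramD(1) by (intro card_le_sum_residue_count) (auto simp: P_def)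
    also have "\<dots> \<le> (\<Sum>i\<in>{0..<int n}. f i)"
      using that by (intro sum_mono) (auto simp: P_def)
    finally show ?thesis by linarith
  qed
  ultimately obtain D where "P D" and max: "\<And>E. P E \<Longrightarrow> card E \<le> card D"
    using ex_has_greatest_nat[of P "{}" card "Suc (nat (\<Sum>i\<in>{0..<int n}. f i))"] by blast
  then have D: "multidiagram r D" and le: "\<And>i. residue_count n \<kappa> D i \<le> f i"
    by (auto simp: P_def)
  have finD: "finite D" by (rule multidiagramD(1)[OF D])
  define g where "g i = f i - residue_count n \<kappa> D i" for i
  have g_per: "g (i mod int n) = g i" for i
    by (simp add: g_def per residue_count_mod)
  have no_addable: "residue n \<kappa> x \<noteq> i mod int n" if x: "x \<in> addable r D" and i: "0 < g i" for x i
  proof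
    assume res: "residue n \<kappa> x = i mod int n"
    have xD: "x \<notin> D" using x by (auto simp: addable_def)
    have "P (D \<union> {x})"
      unfolding P_def
    proof (intro conjI allI)
      show "multidiagram r (D \<union> {x})"
        using x by (intro multidiagram_Un_addable D) auto
      fix j
      have "residue_count n \<kappa> (D \<union> {x}) j =
        residue_count n \<kappa> D j + (if j mod int n = i mod int n then 1 else 0)"
        using residue_count_homogeneous[of "{x}" n \<kappa> i j] res xD finD
          residue_count_Un_disjoint[of D "{x}" n \<kappa> j]
        by simp
      moreover have "g j = g i" if "j mod int n = i mod int n"
        using g_per[of i] g_per[of j] that by simp
      ultimately show "residue_count n \<kappa> (D \<union> {x}) j \<le> f j"
        using le[of j] i by (auto simp: g_def)
    qed
    from max[OF this] show False using xD finD by simp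
  qed
  have conv: "2 * g i \<le> g (i - 1) + g (i + 1)" if i: "0 < g i" for i
  proof -
    have "{x \<in> addable r D. residue n \<kappa> x = i mod int n} = {}"
      using no_addable[OF _ i] by blast
    then have "residue_count n \<kappa> (addable r D) i = 0"
      unfolding residue_count_def by (simp only: card.empty of_nat_0)
    then have "weight n \<kappa> r (residue_count n \<kappa> D) i \<le> 0"
      using addable_minus_removable[OF D, of n \<kappa> i]
        residue_count_nonneg[of n \<kappa> "removable D" i]
      by (simp add: weight_def)
    then show ?thesis
      using dom[of i] by (simp add: weight_def g_def)
  qed
  have "g i = 0" for i
  proof (rule ccontr)
    assume "g i \<noteq> 0"
    then have ex: "\<exists>i. 0 < g i" using le[of i] by (auto simp: g_def intro!: exI[of _ i])
    obtain x where x: "x \<in> addable r D"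
      using addable_nonempty[OF D r] .
    \<comment> \<open>the defect \<open>g\<close> is positive at every residue, in particular at that of the addable node \<open>x\<close>\<close>
    have "0 < g (residue n \<kappa> x)"
      using periodic_subharmonic_positive[OF n g_per ex conv] by blast
    then show False
      using no_addable[OF x, of "residue n \<kappa> x"] by (cases x) (simp add: residue_def)
  qed
  then show thesis
    using D that[of D] by (simp add: g_def)
qed

section \<open>Dividing a content\<close>

lemma charge_count_periodic:
  assumes \<kappa>: "\<And>c. c < d * p \<Longrightarrow> \<kappa> ! c mod int n = \<kappa> ! (c mod d) mod int n"
  shows "charge_count n \<kappa> (d * p) i = int p * charge_count n \<kappa> d i"
proof -
  let ?C = "{c. c < d \<and> \<kappa> ! c mod int n = i mod int n}"
  let ?E = "{c. c < d * p \<and> \<kappa> ! c mod int n = i mod int n}"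
  have "bij_betw (\<lambda>(c, j). c + d * j) (?C \<times> {..<p}) ?E"
  proof (rule bij_betw_byWitness[where f' = "\<lambda>c. (c mod d, c div d)"])
    show "(\<lambda>(c, j). c + d * j) ` (?C \<times> {..<p}) \<subseteq> ?E"
    proof (rule image_subsetI)
      fix x assume "x \<in> ?C \<times> {..<p}"
      then obtain c j where x: "x = (c, j)"
        and *: "c < d" "\<kappa> ! c mod int n = i mod int n" "j \<in> {..<p}" by blast
      have "c + d * j < d * Suc j" using *(1) by simp
      also have "\<dots> \<le> d * p" using *(3) by (intro mult_le_mono2) auto
      finally have lt: "c + d * j < d * p" .
      then show "(case x of (c, j) \<Rightarrow> c + d * j) \<in> ?E"
        using \<kappa>[OF lt] * by (simp add: x)
    qed
    show "(\<lambda>c. (c mod d, c div d)) ` ?E \<subseteq> ?C \<times> {..<p}"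
    proof (rule image_subsetI)
      fix c assume "c \<in> ?E"
      then have *: "c < d * p" "\<kappa> ! c mod int n = i mod int n" by auto
      then have "0 < d" by (cases d) auto
      then show "(c mod d, c div d) \<in> ?C \<times> {..<p}"
        using * \<kappa>[OF *(1)] by (auto simp: less_mult_imp_div_less mult.commute)
    qed
  qed auto
  then have "card (?C \<times> {..<p}) = card ?E" by (rule bij_betw_same_card)
  then have "card ?E = p * card ?C" by (simp add: card_cartesian_product mult.commute)
  then show ?thesis by (simp only: charge_count_def of_nat_mult)
qed

text \<open>
  Repeating the charges \<open>p\<close> times makes the weight of \<open>p f\<close> equal to \<open>p\<close> times the weight of \<open>f\<close>. So
  when the weight of \<open>f\<close> at \<open>i\<close> is \<open>- k < 0\<close>, the large diagram has at least \<open>p k\<close> removable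
  \<open>i\<close>-nodes. Removing \<open>p k\<close> of them keeps the content divisible by \<open>p\<close> and makes the diagram smaller.
  After division the weight at \<open>i\<close> is \<open>k\<close>, which is just enough to add the \<open>k\<close> missing nodes.
\<close>
lemma content_divisible:
  assumes n: "0 < n" and d: "0 < d" and p: "0 < p"
    and \<kappa>: "\<And>c. c < d * p \<Longrightarrow> \<kappa> ! c mod int n = \<kappa> ! (c mod d) mod int n"
    and per: "\<And>i. f (i mod int n) = f i"
    and D: "multidiagram (d * p) D" "\<And>i. residue_count n \<kappa> D i = int p * f i"
  shows "\<exists>E. multidiagram d E \<and> (\<forall>i. residue_count n \<kappa> E i = f i)"
  using per D
proof (induction "card D" arbitrary: D f rule: less_induct)
  case less
  note per = less.prems(1) and D = less.prems(2,3)
  have nonneg: "0 \<le> f i" for i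
    using D(2)[of i] residue_count_nonneg[of n \<kappa> D i] p by (simp add: zero_le_mult_iff)
  show ?case
  proof (cases "\<forall>i. 0 \<le> weight n \<kappa> d f i")
    case True
    then show ?thesis
      using dominant_content_realizable[where f = f and \<kappa> = \<kappa>, OF n d per nonneg] by metis
  next
    case False
    then obtain i where i: "weight n \<kappa> d f i < 0" by (auto simp: not_le)
    define k where "k = nat (- weight n \<kappa> d f i)"
    have k: "weight n \<kappa> d f i = - int k" "0 < k"
      using i by (simp_all add: k_def)
    \<comment> \<open>for \<open>n = 1\<close> every content is dominant, so \<open>i\<close> differs from its neighbours modulo \<open>n\<close>\<close>
    have "n \<noteq> 1"
    proof
      assume "n = 1"
      then have "f j = f 0" for j using per[of j] by simp
      then have "0 \<le> weight n \<kappa> d f i"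
        unfolding weight_def charge_count_def by (metis (no_types, lifting) add_diff_cancel_right'
            diff_add_cancel mult_2 of_nat_0_le_iff add.assoc)
      with i show False by simp
    qed
    then have n2: "1 < n" using n by simp
    \<comment> \<open>\<open>s\<close> is the image of \<open>f\<close> under the simple reflection with index \<open>i\<close>\<close>
    define s where "s j = f j - (if j mod int n = i mod int n then int k else 0)" for j
    have nbr: "(i - 1) mod int n \<noteq> i mod int n" "(i + 1) mod int n \<noteq> i mod int n"
      using n2 by (auto simp: mod_eq_dvd_iff zdvd_not_zless)
    have "charge_count n \<kappa> (d * p) i = int p * charge_count n \<kappa> d i"
      by (rule charge_count_periodic) (rule \<kappa>)
    then have "weight n \<kappa> (d * p) (residue_count n \<kappa> D) i = int p * weight n \<kappa> d f i"
      unfolding weight_def D(2) by (simp only: ring_distribs)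
    then have "weight n \<kappa> (d * p) (residue_count n \<kappa> D) i \<le> - int (p * k)"
      by (simp add: k)
    then obtain D' where D': "multidiagram (d * p) D'" "card D = card D' + p * k"
      "\<And>j. residue_count n \<kappa> D' j =
        residue_count n \<kappa> D j - (if j mod int n = i mod int n then int (p * k) else 0)"
      using remove_nodes[OF D(1)] by blast
    have "card D' < card D" using D'(2) p k by simp
    moreover have "s (j mod int n) = s j" for j by (simp add: s_def per)
    moreover have "residue_count n \<kappa> D' j = int p * s j" for j
      by (simp add: D'(3) D(2) s_def algebra_simps)
    ultimately obtain E where E: "multidiagram d E" "\<And>j. residue_count n \<kappa> E j = s j"
      using less.hyps D'(1) by blast
    have "weight n \<kappa> d (residue_count n \<kappa> E) i = int k"
      using k(1) nbr by (simp add: weight_def E(2) s_def)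
    then obtain F where "multidiagram d F" "\<And>j. residue_count n \<kappa> F j =
        residue_count n \<kappa> E j + (if j mod int n = i mod int n then int k else 0)"
      using add_nodes[OF E(1), of k n \<kappa> i] by (metis order_refl)
    then show ?thesis
      by (intro exI[of _ F]) (simp add: E(2) s_def)
  qed
qed

section \<open>Multipartitions and multidiagrams\<close>

lemma sorted_wrt_ge_nth_mono:
  fixes xs :: "nat list"
  assumes "sorted_wrt (\<ge>) xs" "i \<le> j" "j < length xs"
  shows "xs ! j \<le> xs ! i"
  using assms sorted_wrt_nth_less[of "(\<ge>)" xs i j] by (cases "i = j") auto

lemma multidiagram_multi_young_diagram:
  assumes L: "is_multipartition r L"
  shows "multidiagram r (multi_young_diagram L)"
proof -
  have step: "L ! c ! Suc a \<le> L ! c ! a" if "c < length L" "Suc a < length (L ! c)" for a c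
    using that L by (intro sorted_wrt_ge_nth_mono)
      (auto simp: is_multipartition_def is_partition_def)
  have mem: "(a, b, c) \<in> multi_young_diagram L \<longleftrightarrow>
      c < length L \<and> a < length (L ! c) \<and> b < L ! c ! a" for a b c
    by (simp add: multi_young_diagram_def young_diagram_def)
  show ?thesis
  proof (rule multidiagramI)
    show "(a, b, c) \<in> multi_young_diagram L \<Longrightarrow> c < r" for a b c
      using L by (simp add: mem is_multipartition_def)
    show "(Suc a, b, c) \<in> multi_young_diagram L \<Longrightarrow> (a, b, c) \<in> multi_young_diagram L" for a b c
      using step[of c a] by (simp add: mem)
  qed (simp_all add: mem finite_multi_young_diagram)
qed

lemma finite_downclosed_eq_lessThan:
  fixes S :: "nat set"
  assumes "finite S" "\<And>m. Suc m \<in> S \<Longrightarrow> m \<in> S"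
  shows "S = {..<card S}"
proof -
  have down: "k \<in> S" if "m \<in> S" "k \<le> m" for k m
    using that(2)
  proof (induction rule: inc_induct)
    case (step n)
    show ?case by (rule assms(2)[OF step.IH])
  qed (rule that(1))
  define l where "l = (LEAST m. m \<notin> S)"
  have ex: "\<exists>m. m \<notin> S" using assms(1) ex_new_if_finite by blast
  have "l \<notin> S" "\<And>m. m < l \<Longrightarrow> m \<in> S"
    using LeastI_ex[OF ex] not_less_Least[of _ "\<lambda>m. m \<notin> S"] unfolding l_def by blast+
  then have "m \<in> S \<longleftrightarrow> m < l" for m using down[of m l] by (cases "m < l") auto
  then have "S = {..<l}" by blast
  then show ?thesis by simp
qed

lemma downclosed_eq_young_diagram:
  assumes fin: "finite Y" and up: "\<And>a b. (Suc a, b) \<in> Y \<Longrightarrow> (a, b) \<in> Y"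
    and left: "\<And>a b. (a, Suc b) \<in> Y \<Longrightarrow> (a, b) \<in> Y"
  obtains xs where "is_partition xs" "young_diagram xs = Y"
proof -
  \<comment> \<open>\<open>h\<close> is the number of nonempty rows, so that the parts listed below are positive\<close>
  define row where "row a = card {b. (a, b) \<in> Y}" for a
  define h where "h = card {a. (a, 0) \<in> Y}"
  have fin_row: "finite {b. (a, b) \<in> Y}" for a
    using finite_imageI[OF fin, of snd] by (rule rev_finite_subset) force
  have "{b. (a, b) \<in> Y} = {..<row a}" for a
    unfolding row_def
  proof (rule finite_downclosed_eq_lessThan[OF fin_row])
    show "Suc b \<in> {b. (a, b) \<in> Y} \<Longrightarrow> b \<in> {b. (a, b) \<in> Y}" for b
      using left[of a b] by simp
  qed
  then have row: "(a, b) \<in> Y \<longleftrightarrow> b < row a" for a b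
    by blast
  have "finite {a. (a, 0) \<in> Y}"
    using finite_imageI[OF fin, of fst] by (rule rev_finite_subset) force
  then have "{a. (a, 0) \<in> Y} = {..<h}"
    unfolding h_def
  proof (rule finite_downclosed_eq_lessThan)
    show "Suc a \<in> {a. (a, 0) \<in> Y} \<Longrightarrow> a \<in> {a. (a, 0) \<in> Y}" for a
      using up[of a 0] by simp
  qed
  then have h: "(a, 0) \<in> Y \<longleftrightarrow> a < h" for a
    by blast
  have "row (Suc a) \<le> row a" for a
    using up[of a "row a"] unfolding row by (meson less_irrefl not_le)
  then have anti: "row b \<le> row a" if "a \<le> b" for a b
    using that by (rule lift_Suc_antimono_le)
  show thesis
  proof
    show "is_partition (map row [0..<h])"
      using anti h row by (auto simp: is_partition_def sorted_wrt_iff_nth_less)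
    have "a < h" if "(a, b) \<in> Y" for a b
      using that row[of a b] row[of a 0] h[of a] by simp
    then show "young_diagram (map row [0..<h]) = Y"
      using row by (auto simp: young_diagram_def)
  qed
qed

lemma multidiagram_eq_multi_young_diagram:
  assumes D: "multidiagram r D"
  obtains M where "is_multipartition r M" "multi_young_diagram M = D"
proof -
  have "\<exists>xs. is_partition xs \<and> young_diagram xs = {(a, b). (a, b, c) \<in> D}" for c
  proof -
    let ?Y = "{(a, b). (a, b, c) \<in> D}"
    have "?Y \<subseteq> (\<lambda>(a, b, c). (a, b)) ` D"
      by force
    then have "finite ?Y"
      using multidiagramD(1)[OF D] finite_surj by blast
    then obtain xs where "is_partition xs" "young_diagram xs = ?Y"
    proof (rule downclosed_eq_young_diagram)
      show "(Suc a, b) \<in> ?Y \<Longrightarrow> (a, b) \<in> ?Y" "(a, Suc b) \<in> ?Y \<Longrightarrow> (a, b) \<in> ?Y" for a b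
        using multidiagramD(3,4)[OF D, of a b c] by simp_all
    qed
    then show ?thesis by blast
  qed
  then obtain P where P: "\<And>c. is_partition (P c)"
    "\<And>c. young_diagram (P c) = {(a, b). (a, b, c) \<in> D}" by metis
  show thesis
  proof
    show "is_multipartition r (map P [0..<r])"
      using P(1) by (auto simp: is_multipartition_def)
    show "multi_young_diagram (map P [0..<r]) = D"
      using multidiagramD(2)[OF D] P(2) by (auto simp: multi_young_diagram_def)
  qed
qed

lemma lookup_alpha:
  "Poly_Mapping.lookup (alpha e \<kappa> L) i =
    int (card {x \<in> multi_young_diagram L. residue e \<kappa> x = i})"
  using finite_multi_young_diagram[of L]
  by (simp add: alpha_def lookup_sum lookup_frag_of sum.If_cases Int_def eq_commute[of i])

section \<open>Residues modulo a divisor\<close>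

text \<open>Each residue class modulo \<open>m\<close> is the disjoint union of \<open>p\<close> residue classes modulo \<open>m p\<close>.\<close>
lemma sum_of_bool_mod_product:
  fixes u i :: int
  assumes "0 < m" "0 < p"
  shows "(\<Sum>j<p. of_bool ((u + int j * int m) mod int (m * p) = i mod int (m * p))) =
    (of_bool (u mod int m = i mod int m) :: int)"
proof (cases "u mod int m = i mod int m")
  case True
  then obtain q where q: "i - u = int m * q"
    by (metis dvdE mod_eq_dvd_iff)
  have "(u + int j * int m) mod int (m * p) = i mod int (m * p) \<longleftrightarrow> j = nat (q mod int p)"
    if "j < p" for j
  proof -
    have "(u + int j * int m) - i = int m * (int j - q)"
      using q by (simp add: algebra_simps)
    then have "(u + int j * int m) mod int (m * p) = i mod int (m * p) \<longleftrightarrow> int p dvd int j - q"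
      using assms by (simp add: mod_eq_dvd_iff)
    also have "\<dots> \<longleftrightarrow> int j = q mod int p"
      using that by (metis mod_eq_dvd_iff mod_pos_pos_trivial of_nat_0_le_iff of_nat_less_iff mod_mod_trivial)
    finally show ?thesis using assms by auto
  qed
  then have "(\<Sum>j<p. of_bool ((u + int j * int m) mod int (m * p) = i mod int (m * p)) :: int) =
    (\<Sum>j<p. of_bool (j = nat (q mod int p)))"
    by (intro sum.cong) auto
  also have "\<dots> = 1"
    using assms by (simp add: of_bool_def nat_less_iff)
  finally show ?thesis using True by simp
next
  case False
  have "(u + int j * int m) mod int (m * p) \<noteq> i mod int (m * p)" for j
  proof
    assume "(u + int j * int m) mod int (m * p) = i mod int (m * p)"
    then have "(u + int j * int m) mod int m = i mod int m"
      by (metis mod_mult_right_eq mod_mod_cancel dvd_triv_left of_nat_mult)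
    then show False using False by simp
  qed
  then show ?thesis using False by simp
qed

lemma residue_count_coarsen:
  assumes "0 < m" "0 < p" "finite D"
  shows "residue_count m \<kappa> D i = (\<Sum>j<p. residue_count (m * p) \<kappa> D (i + int j * int m))"
proof -
  have "(of_bool (residue m \<kappa> x = i mod int m) :: int) =
    (\<Sum>j<p. of_bool (residue (m * p) \<kappa> x = (i + int j * int m) mod int (m * p)))" for x
  proof -
    obtain a b c where x: "x = (a, b, c)" by (cases x)
    show ?thesis
      using sum_of_bool_mod_product[OF assms(1,2), of i "int b - int a + \<kappa> ! c"]
      by (simp add: x residue_def eq_commute)
  qed
  then have "residue_count m \<kappa> D i =
    (\<Sum>x\<in>D. \<Sum>j<p. of_bool (residue (m * p) \<kappa> x = (i + int j * int m) mod int (m * p)))"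
    unfolding residue_count_eq_sum[OF assms(3)] by (simp only:)
  also have "\<dots> = (\<Sum>j<p. residue_count (m * p) \<kappa> D (i + int j * int m))"
    unfolding residue_count_eq_sum[OF assms(3)] by (rule sum.swap)
  finally show ?thesis .
qed

section \<open>Compatible multicharges and shift-stable multipartitions\<close>

lemma compatible_nth:
  assumes "compatible d \<eta> p \<kappa>" "c < d" "j < p" "set \<kappa> \<subseteq> {0..<int (\<eta> * p)}" "length \<kappa> = d * p"
  shows "\<kappa> ! (c + j * d) = (\<kappa> ! c + int j * int \<eta>) mod int (\<eta> * p)"
  using assms(3)
proof (induction j)
  case 0
  have "c < d * p" using assms(2) 0 by (cases p) auto
  then have "\<kappa> ! c \<in> {0..<int (\<eta> * p)}" using assms(4,5) by (metis nth_mem subsetD)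
  then show ?case by simp
next
  case (Suc j)
  have "c + Suc j * d < d + Suc j * d" using assms(2) by simp
  also have "\<dots> \<le> d * p"
    using Suc.prems mult_le_mono2[of "Suc (Suc j)" p d] by (simp add: mult.commute)
  finally have lt: "c + j * d + d < d * p" by simp
  then have "\<kappa> ! (c + j * d + d) = (\<kappa> ! (c + j * d) + int \<eta>) mod int (\<eta> * p)"
    using assms(1) unfolding compatible_def by (metis add_lessD1 mod_less)
  also have "\<dots> = (\<kappa> ! c + int (Suc j) * int \<eta>) mod int (\<eta> * p)"
    using Suc by (simp add: mod_simps algebra_simps)
  finally show ?case by (simp add: ac_simps)
qed

lemma residue_count_shift_invariant:
  assumes "shift_Q e \<eta> (alpha e \<kappa> L) = alpha e \<kappa> L"
  shows "residue_count e \<kappa> (multi_young_diagram L) (i + int \<eta>) =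
    residue_count e \<kappa> (multi_young_diagram L) i"
proof -
  let ?Y = "multi_young_diagram L"
  have "shift_Q e \<eta> (alpha e \<kappa> L) = (\<Sum>x\<in>?Y. frag_of ((residue e \<kappa> x + int \<eta>) mod int e))"
    using finite_multi_young_diagram[of L]
    by (simp add: shift_Q_def alpha_def frag_extend_sum comp_def)
  then have "int (card {x \<in> ?Y. (residue e \<kappa> x + int \<eta>) mod int e = (i + int \<eta>) mod int e}) =
    Poly_Mapping.lookup (shift_Q e \<eta> (alpha e \<kappa> L)) ((i + int \<eta>) mod int e)"
    using finite_multi_young_diagram[of L]
    by (simp add: lookup_sum lookup_frag_of sum.If_cases Int_def
        eq_commute[of "(i + int \<eta>) mod int e"])
  moreover have "(residue e \<kappa> x + int \<eta>) mod int e = (i + int \<eta>) mod int e \<longleftrightarrow>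
    residue e \<kappa> x = i mod int e" for x
    by (cases x) (simp add: residue_def mod_simps mod_eq_dvd_iff)
  ultimately show ?thesis
    by (simp add: assms lookup_alpha residue_count_def)
qed

lemma nth_concat_replicate:
  assumes "c < length xs * p"
  shows "concat (replicate p xs) ! c = xs ! (c mod length xs)"
  using assms
proof (induction p arbitrary: c)
  case (Suc p)
  show ?case
  proof (cases "c < length xs")
    case False
    then show ?thesis
      using Suc.IH[of "c - length xs"] Suc.prems by (simp add: nth_append le_mod_geq)
  qed (simp add: nth_append)
qed simp

lemma shift_multipartition_concat_replicate:
  assumes "length xs = d"
  shows "shift_multipartition d (concat (replicate p xs)) = concat (replicate p xs)"
proof (cases p)
  case (Suc q)
  have "concat (replicate p xs) = concat (replicate q xs) @ xs"
    unfolding Suc using replicate_append_same[of q xs]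
    by (metis concat.simps concat_append append_Nil2 replicate_Suc)
  moreover have "concat (replicate p xs) = xs @ concat (replicate q xs)"
    by (simp add: Suc)
  ultimately show ?thesis
    unfolding shift_multipartition_def
    using assms by (metis add_diff_cancel_right' append_eq_conv_conj length_append)
qed (simp add: shift_multipartition_def)

lemma length_concat_replicate: "length (concat (replicate p xs)) = length xs * p"
  by (induction p) auto

text \<open>
  The \<open>j\<close>-th copy of a component has its charge raised by \<open>j \<eta>\<close>. So the copies of a node of residue
  \<open>u\<close> have the residues \<open>u + j \<eta>\<close> for \<open>j < p\<close>, and exactly one of these is \<open>i\<close> modulo \<open>\<eta> p\<close>
  if \<open>u\<close> is \<open>i\<close> modulo \<open>\<eta>\<close>, and none otherwise.
\<close>
lemma residue_count_concat_replicate: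
  assumes \<kappa>: "compatible d \<eta> p \<kappa>" "set \<kappa> \<subseteq> {0..<int (\<eta> * p)}" "length \<kappa> = d * p"
    and pos: "0 < \<eta>" "0 < p" and len: "length xs = d"
  shows "residue_count (\<eta> * p) \<kappa> (multi_young_diagram (concat (replicate p xs))) i =
    residue_count \<eta> \<kappa> (multi_young_diagram xs) i"
proof -
  let ?Y = "multi_young_diagram xs"
  let ?e = "\<eta> * p"
  let ?g = "\<lambda>((a, b, c), j). (a, b, c + j * d)"
  have fin: "finite ?Y" by (rule finite_multi_young_diagram)
  have lt: "c + j * d < d * p" if "c < d" "j < p" for c j
  proof -
    have "c + j * d < Suc j * d" using that by simp
    also have "\<dots> \<le> p * d" using that by (intro mult_le_mono1) auto
    finally show ?thesis by (simp add: mult.commute)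
  qed
  have inj: "inj_on ?g (?Y \<times> {..<p})"
  proof (rule inj_on_inverseI)
    fix y assume y: "y \<in> ?Y \<times> {..<p}"
    obtain a b c j where "y = ((a, b, c), j)" by (metis prod.collapse)
    moreover from this y have "c < d" using len by (simp add: multi_young_diagram_def)
    ultimately show "(\<lambda>(a, b, c). ((a, b, c mod d), c div d)) (?g y) = y"
      by simp
  qed
  have img: "multi_young_diagram (concat (replicate p xs)) = ?g ` (?Y \<times> {..<p})"
  proof (rule set_eqI)
    fix x :: "nat \<times> nat \<times> nat"
    obtain a b c where x: "x = (a, b, c)" by (cases x)
    show "x \<in> multi_young_diagram (concat (replicate p xs)) \<longleftrightarrow> x \<in> ?g ` (?Y \<times> {..<p})"
    proof
      assume "x \<in> multi_young_diagram (concat (replicate p xs))"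
      then have c: "c < d * p" and ab: "(a, b) \<in> young_diagram (xs ! (c mod d))"
        using len by (auto simp: x multi_young_diagram_def length_concat_replicate nth_concat_replicate)
      then have "0 < d" by (cases d) auto
      then have "((a, b, c mod d), c div d) \<in> ?Y \<times> {..<p}"
        using c ab len by (auto simp: multi_young_diagram_def less_mult_imp_div_less mult.commute)
      then show "x \<in> ?g ` (?Y \<times> {..<p})"
        by (rule rev_image_eqI) (simp add: x)
    next
      assume "x \<in> ?g ` (?Y \<times> {..<p})"
      then obtain c' j where "c = c' + j * d" "(a, b, c') \<in> ?Y" "j < p"
        by (auto simp: x)
      then show "x \<in> multi_young_diagram (concat (replicate p xs))"
        using len lt[of c' j]
        by (auto simp: x multi_young_diagram_def length_concat_replicate nth_concat_replicate)
    qed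
  qed
  have "residue_count ?e \<kappa> (multi_young_diagram (concat (replicate p xs))) i =
    (\<Sum>y\<in>?Y \<times> {..<p}. of_bool (residue ?e \<kappa> (?g y) = i mod int ?e))"
    using finite_multi_young_diagram[of "concat (replicate p xs)"]
    by (simp add: residue_count_eq_sum img sum.reindex[OF inj] del: of_nat_mult)
  also have "\<dots> = (\<Sum>x\<in>?Y. \<Sum>j<p. of_bool (residue ?e \<kappa> (?g (x, j)) = i mod int ?e))"
    by (subst sum.cartesian_product) (rule sum.cong, auto)
  also have "\<dots> = (\<Sum>x\<in>?Y. of_bool (residue \<eta> \<kappa> x = i mod int \<eta>))"
  proof (rule sum.cong)
    fix x assume xY: "x \<in> ?Y"
    obtain a b c where x: "x = (a, b, c)" by (cases x)
    have c: "c < d" using xY len by (auto simp: x multi_young_diagram_def)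
    have "residue ?e \<kappa> (?g (x, j)) = (int b - int a + \<kappa> ! c + int j * int \<eta>) mod int ?e"
      if "j < p" for j
      using compatible_nth[OF \<kappa>(1) c that \<kappa>(2,3)]
      by (simp add: x residue_def mod_simps add.assoc del: of_nat_mult)
    then show "(\<Sum>j<p. of_bool (residue ?e \<kappa> (?g (x, j)) = i mod int ?e)) =
      (of_bool (residue \<eta> \<kappa> x = i mod int \<eta>) :: int)"
      using sum_of_bool_mod_product[OF pos, of "int b - int a + \<kappa> ! c" i]
      by (simp add: x residue_def del: of_nat_mult)
  qed simp
  also have "\<dots> = residue_count \<eta> \<kappa> ?Y i"
    by (simp add: residue_count_eq_sum fin)
  finally show ?thesis .
qed

theorem theorem2p30:
  fixes d \<eta> p e r :: nat
    and \<kappa> :: "int list"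
    and L :: "nat list list"
    and \<alpha> :: "int \<Rightarrow>\<^sub>0 int"
  assumes "d \<ge> 1" and "\<eta> \<ge> 1" and "p \<ge> 1"
    and "e = \<eta> * p" and "e \<ge> 2" and "r = d * p"
    and "multicharge e r \<kappa>"
    and "compatible d \<eta> p \<kappa>"
    and "is_multipartition r L"
    and "\<alpha> = alpha e \<kappa> L"
    and "shift_Q e \<eta> \<alpha> = \<alpha>"
  shows "\<exists>M. is_multipartition r M \<and> alpha e \<kappa> M = \<alpha> \<and> shift_multipartition d M = M"
proof -
  let ?Y = "multi_young_diagram L"
  define f where "f = residue_count e \<kappa> ?Y"
  have pos: "0 < \<eta>" "0 < d" "0 < p" using assms(1-3) by auto
  have \<kappa>: "set \<kappa> \<subseteq> {0..<int (\<eta> * p)}" "length \<kappa> = d * p"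
    using assms(4,6,7) by (auto simp: multicharge_def)
  have shift: "f (i + int \<eta>) = f i" for i
    using residue_count_shift_invariant assms(10,11) by (simp add: f_def)
  have shifts: "f (i + int j * int \<eta>) = f i" for i j
  proof (induction j)
    case (Suc j)
    then show ?case using shift[of "i + int j * int \<eta>"] by (simp add: algebra_simps)
  qed simp
  have per: "f (i mod int \<eta>) = f i" for i
  proof -
    \<comment> \<open>\<open>i\<close> is \<open>i mod \<eta> + q \<eta>\<close>, and modulo \<open>\<eta> p\<close> only \<open>q mod p\<close> matters, a natural number\<close>
    define q where "q = i div int \<eta>"
    have "f (i mod int \<eta>) = f (i mod int \<eta> + int (nat (q mod int p)) * int \<eta>)"
      by (simp only: shifts)
    also have "\<dots> = f i"
      unfolding f_def
    proof (rule residue_count_cong)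
      have "int e dvd (i mod int \<eta> + (q mod int p) * int \<eta>) - i"
      proof -
        have "(i mod int \<eta> + (q mod int p) * int \<eta>) - i = int \<eta> * (q mod int p - q)"
          by (simp add: q_def algebra_simps minus_mult_div_eq_mod[symmetric])
        moreover have "int p dvd q mod int p - q"
          by (simp add: mod_eq_dvd_iff[symmetric])
        ultimately show ?thesis by (simp add: assms(4) mult_dvd_mono)
      qed
      then show "(i mod int \<eta> + int (nat (q mod int p)) * int \<eta>) mod int e = i mod int e"
        using pos by (simp add: mod_eq_dvd_iff)
    qed
    finally show ?thesis .
  qed
  have charges: "\<kappa> ! c mod int \<eta> = \<kappa> ! (c mod d) mod int \<eta>" if "c < d * p" for c
  proof -
    have "c div d < p" using that by (simp add: less_mult_imp_div_less mult.commute)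
    then have "\<kappa> ! (c mod d + c div d * d) = (\<kappa> ! (c mod d) + int (c div d) * int \<eta>) mod int (\<eta> * p)"
      using pos by (intro compatible_nth assms(8) \<kappa>) auto
    then show ?thesis
      by (simp add: mod_mod_cancel)
  qed
  have "residue_count \<eta> \<kappa> ?Y i = int p * f i" for i
    using residue_count_coarsen[OF pos(1,3) finite_multi_young_diagram[of L], of \<kappa> i]
    by (simp add: shifts assms(4)[symmetric] f_def[symmetric] del: of_nat_mult)
  then obtain E where E: "multidiagram d E" "\<And>i. residue_count \<eta> \<kappa> E i = f i"
    using content_divisible[where f = f, OF pos charges per]
      multidiagram_multi_young_diagram[OF assms(9)] assms(6) by metis
  then obtain xs where xs: "is_multipartition d xs" "multi_young_diagram xs = E"
    using multidiagram_eq_multi_young_diagram by blast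
  then have len: "length xs = d" by (simp add: is_multipartition_def)
  define M where "M = concat (replicate p xs)"
  have count: "residue_count e \<kappa> (multi_young_diagram M) i = f i" for i
    unfolding M_def assms(4)
    using residue_count_concat_replicate[OF assms(8) \<kappa> pos(1,3) len] xs(2) E(2) by simp
  have "alpha e \<kappa> M = \<alpha>"
  proof (rule poly_mapping_eqI)
    fix i
    show "Poly_Mapping.lookup (alpha e \<kappa> M) i = Poly_Mapping.lookup \<alpha> i"
    proof (cases "i mod int e = i")
      case True
      then show ?thesis
        using count[of i] by (simp add: lookup_alpha assms(10) f_def residue_count_def)
    next
      case False
      then have "residue e \<kappa> x \<noteq> i" for x
        by (cases x) (auto simp: residue_def)
      then show ?thesis by (simp add: lookup_alpha assms(10))
    qed
  qed
  moreover have "is_multipartition r M"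
    using xs(1) len by (auto simp: M_def is_multipartition_def length_concat_replicate assms(6)
        split: if_splits)
  moreover have "shift_multipartition d M = M"
    unfolding M_def by (rule shift_multipartition_concat_replicate[OF len])
  ultimately show ?thesis by blast
qed

end
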